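(* Let $n\ge 1$, let $D\subseteq\mathbb{Z}_4^n$ be a transversal of the subgroup $2\mathbb{Z}_4^n$ in $\mathbb{Z}_4^n$, let $h:\mathbb{F}_2^n\to\mathbb{F}_2^n$ be its $\mathbb{F}_2^n$-representation, let $B$ be a basis of $\mathbb{F}_{2^n}$ over $\mathbb{F}_2$ and let $f_B\in\mathbb{F}_{2^n}[x]$ be the $\mathbb{F}_{2^n}$-representation of $D$ with respect to $B$. Then the following are equivalent: (1) $D$ is a $(2^n,2^n,2^n,1)$-relative difference set in $\mathbb{Z}_4^n$ relative to $2\mathbb{Z}_4^n$; (2) for each nonzero $a\in\mathbb{F}_2^n$ the map $\Delta_{h,a}:d\mapsto h(d+a)+h(d)+d\odot a$ is a bijection of $\mathbb{F}_2^n$; (3) for each nonzero $a\in\mathbb{F}_{2^n}$ the polynomial $\nabla_{f_B,a}(x):=f_B(x+a)+f_B(x)+f_B(a)+xa$ is a permutation polynomial of $\mathbb{F}_{2^n}$.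
   Context: A $k$-subset $D$ of a group $G$ of order $mn$ with subgroup $N$ of order $n$ is an $(m,n,k,\lambda)$-relative difference set relative to $N$ if every element of $G\setminus N$ is represented exactly $\lambda$ times as a difference $d-d'$ with $d,d'\in D$, and no nonzero element of $N$ is so represented. Let $\psi:\mathbb{F}_2\to\mathbb{Z}_4=\{0,1,2,3\}$ be given by $0\mapsto 0$, $1\mapsto 1$, and $\Psi:\mathbb{F}_2^n\to\mathbb{Z}_4^n$ apply $\psi$ coordinatewise. Every element of $\mathbb{Z}_4^n$ is uniquely of the form $\lfloor a,b\rfloor:=\Psi(a)+2\Psi(b)$ with $a,b\in\mathbb{F}_2^n$. For $a,c\in\mathbb{F}_2^n$, $a\odot c=(a_0c_0,\dots,a_{n-1}c_{n-1})$. If $D$ is a transversal of $2\mathbb{Z}_4^n=\{\lfloor 0,b\rfloor\}$, each element of $D$ is uniquely $\lfloor d,h(d)\rfloor$ for a map $h:\mathbb{F}_2^n\to\mathbb{F}_2^n$, called the $\mathbb{F}_2^n$-representation of $D$. For a basis $B=\{\xi_0,\dots,\xi_{n-1}\}$ of $\mathbb{F}_{2^n}$ over $\mathbb{F}_2$, identify $x=\sum x_i\xi_i\in\mathbb{F}_{2^n}$ with $(x_0,\dots,x_{n-1})\in\mathbb{F}_2^n$; let $h_B:\mathbb{F}_{2^n}\to\mathbb{F}_{2^n}$ be $h$ viewed via this identification (written as a polynomial), let $\mu_B(x)=\sum_{i<j}x_ix_j\xi_i\xi_j$, and define $f_B(x)=h_B(x)^2+\mu_B(x)$, the $\mathbb{F}_{2^n}$-representation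 of $D$ with respect to $B$. *)

theory Defs
  imports
    "HOL-Analysis.Finite_Cartesian_Product"
    "HOL-Library.Numeral_Type"
    "HOL-Library.Z2"
    "HOL-Computational_Algebra.Polynomial"
begin

section \<open>Relative difference sets and transversals\<close>

definition add_subgroup :: "'g::group_add set \<Rightarrow> bool" where
  "add_subgroup N \<longleftrightarrow> 0 \<in> N \<and> (\<forall>x\<in>N. \<forall>y\<in>N. x - y \<in> N)"

text \<open>The ambient group is the whole (finite) type.\<close>

definition relative_difference_set ::
    "nat \<Rightarrow> nat \<Rightarrow> nat \<Rightarrow> nat \<Rightarrow> 'g::{group_add,finite} set \<Rightarrow> 'g set \<Rightarrow> bool" where
  "relative_difference_set m n k l N D \<longleftrightarrow>
     CARD('g) = m * n \<and> add_subgroup N \<and> card N = n \<and> card D = k \<and>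
     (\<forall>g. g \<notin> N \<longrightarrow> card {(d, d'). d \<in> D \<and> d' \<in> D \<and> d - d' = g} = l) \<and>
     (\<forall>g\<in>N. g \<noteq> 0 \<longrightarrow> \<not> (\<exists>d\<in>D. \<exists>d'\<in>D. d - d' = g))"

definition transversal :: "'g::ab_group_add set \<Rightarrow> 'g set \<Rightarrow> bool" where
  "transversal N D \<longleftrightarrow> (\<forall>x. \<exists>!d. d \<in> D \<and> d - x \<in> N)"

section \<open>Coordinates on \<open>\<int>\<^sub>4\<^sup>n\<close>\<close>

text \<open>Here \<open>\<F>\<^sub>2\<^sup>n\<close> is \<open>bit ^ 'n\<close> and \<open>\<int>\<^sub>4\<^sup>n\<close> is \<open>4 ^ 'n\<close> with \<open>n = CARD('n)\<close>; on vectors, \<open>+\<close>, \<open>*\<close> and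
  numerals are componentwise.\<close>

definition psi :: "bit \<Rightarrow> 4" where
  "psi b = (if b = 0 then 0 else 1)"

definition Psi :: "bit ^ 'n::finite \<Rightarrow> 4 ^ 'n" where
  "Psi a = (\<chi> i. psi (a $ i))"

definition Z4_pair :: "bit ^ 'n::finite \<Rightarrow> bit ^ 'n \<Rightarrow> 4 ^ 'n" where
  "Z4_pair a b = Psi a + 2 * Psi b"

definition two_Z4 :: "(4 ^ 'n::finite) set" where
  "two_Z4 = range (\<lambda>x. 2 * x)"

definition odot :: "bit ^ 'n::finite \<Rightarrow> bit ^ 'n \<Rightarrow> bit ^ 'n" (infixl "\<odot>" 70) where
  "a \<odot> c = (\<chi> i. a $ i * c $ i)"

definition F2_representation :: "(4 ^ 'n::finite) set \<Rightarrow> bit ^ 'n \<Rightarrow> bit ^ 'n" where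
  "F2_representation D d = (THE e. Z4_pair d e \<in> D)"

definition Delta :: "(bit ^ 'n::finite \<Rightarrow> bit ^ 'n) \<Rightarrow> bit ^ 'n \<Rightarrow> bit ^ 'n \<Rightarrow> bit ^ 'n" where
  "Delta h a d = h (d + a) + h d + d \<odot> a"

section \<open>The field of order \<open>2\<^sup>n\<close>\<close>

text \<open>Scalar multiplication of a field of characteristic 2 by its prime field.\<close>

definition F2_scale :: "bit \<Rightarrow> 'f::field \<Rightarrow> 'f" where
  "F2_scale c x = (if c = 0 then 0 else x)"

definition F2_basis :: "('n::finite \<Rightarrow> 'f::field) \<Rightarrow> bool" where
  "F2_basis \<xi> \<longleftrightarrow> inj \<xi> \<and> \<not> module.dependent F2_scale (range \<xi>) \<and>
     module.span F2_scale (range \<xi>) = UNIV"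

definition of_coords :: "('n::finite \<Rightarrow> 'f::field) \<Rightarrow> bit ^ 'n \<Rightarrow> 'f" where
  "of_coords \<xi> v = (\<Sum>i\<in>UNIV. F2_scale (v $ i) (\<xi> i))"

definition coords :: "('n::finite \<Rightarrow> 'f::field) \<Rightarrow> 'f \<Rightarrow> bit ^ 'n" where
  "coords \<xi> = inv (of_coords \<xi>)"

definition h_B :: "('n::finite \<Rightarrow> 'f::field) \<Rightarrow> (bit ^ 'n \<Rightarrow> bit ^ 'n) \<Rightarrow> 'f \<Rightarrow> 'f" where
  "h_B \<xi> h x = of_coords \<xi> (h (coords \<xi> x))"

text \<open>The linear order on \<open>'n\<close> plays the role of the order on the indices \<open>0, \<dots>, n - 1\<close>; the summand is
  symmetric in \<open>i\<close> and \<open>j\<close>.\<close>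

definition mu_B :: "('n::{finite,linorder} \<Rightarrow> 'f::field) \<Rightarrow> 'f \<Rightarrow> 'f" where
  "mu_B \<xi> x = (\<Sum>(i, j) | i < j. F2_scale (coords \<xi> x $ i * coords \<xi> x $ j) (\<xi> i * \<xi> j))"

text \<open>The unique polynomial of degree below \<open>q\<close> inducing a given map on the field with \<open>q\<close> elements.\<close>

definition poly_of_map :: "('f::{field,finite} \<Rightarrow> 'f) \<Rightarrow> 'f poly" where
  "poly_of_map g = (THE p. degree p < CARD('f) \<and> poly p = g)"

definition Fq_representation ::
    "('n::{finite,linorder} \<Rightarrow> 'f::{field,finite}) \<Rightarrow> (4 ^ 'n::{finite,linorder}) set \<Rightarrow> 'f poly" where
  "Fq_representation \<xi> D =
     poly_of_map (\<lambda>x. (h_B \<xi> (F2_representation D) x)\<^sup>2 + mu_B \<xi> x)"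

definition nabla :: "'f::field poly \<Rightarrow> 'f \<Rightarrow> 'f poly" where
  "nabla f a = f \<circ>\<^sub>p [:a, 1:] + f + [:poly f a:] + [:0, a:]"

definition permutation_polynomial :: "'f::{field,finite} poly \<Rightarrow> bool" where
  "permutation_polynomial p \<longleftrightarrow> bij (poly p)"

section \<open>Well-definedness\<close>

lemma UNIV_4: "(UNIV :: 4 set) = {0, 1, 2, 3}"
proof -
  have "card {0, 1, 2, 3 :: 4} = 4" by simp
  then show ?thesis by (intro card_subset_eq [symmetric]) auto
qed

lemma psi_inject: "psi a + 2 * psi b = psi a' + 2 * psi b' \<longleftrightarrow> a = a' \<and> b = b'"
proof -
  have "(0::4) \<noteq> 1" "(0::4) \<noteq> 2" "(0::4) \<noteq> 3" "(1::4) \<noteq> 2" "(1::4) \<noteq> 3" "(2::4) \<noteq> 3"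
    and "(1::4) + 2 = 3"
    by simp_all
  then have "psi a + 2 * psi b = psi a' + 2 * psi b' \<longleftrightarrow> (a = 0) = (a' = 0) \<and> (b = 0) = (b' = 0)"
    by (cases "a = 0"; cases "b = 0"; cases "a' = 0"; cases "b' = 0")
      (simp_all only: psi_def if_True if_False mult_zero_right mult_1_right add_0_left add_0_right
        simp_thms not_sym)
  moreover have "(c = 0) = (c' = 0) \<longleftrightarrow> c = c'" for c c' :: bit
    by (cases c; cases c') simp_all
  ultimately show ?thesis by (simp only:)
qed

lemma psi_surj: "\<exists>a b. psi a + 2 * psi b = x"
proof -
  have "psi 0 + 2 * psi 0 = 0" "psi 1 + 2 * psi 0 = 1" "psi 0 + 2 * psi 1 = 2" "psi 1 + 2 * psi 1 = 3"
    by (simp_all add: psi_def)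
  moreover have "x \<in> {0, 1, 2, 3}" using UNIV_4 by auto
  ultimately show ?thesis by blast
qed

lemma Z4_pair_nth: "Z4_pair a b $ i = psi (a $ i) + 2 * psi (b $ i)"
  by (simp add: Z4_pair_def Psi_def)

lemma Z4_pair_inject: "Z4_pair a b = Z4_pair a' b' \<longleftrightarrow> a = a' \<and> b = b'"
  by (auto simp: vec_eq_iff Z4_pair_nth psi_inject)

lemma Z4_pair_surj: "\<exists>a b. x = Z4_pair a b"
proof -
  have "\<forall>i. \<exists>a b. psi a + 2 * psi b = x $ i" by (simp add: psi_surj)
  then obtain p q where "\<And>i. psi (p i) + 2 * psi (q i) = x $ i" unfolding choice_iff by blast
  then have "x = Z4_pair (\<chi> i. p i) (\<chi> i. q i)" by (simp add: vec_eq_iff Z4_pair_nth)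
  then show ?thesis by blast
qed

lemma two_Z4_eq: "two_Z4 = {Z4_pair 0 b | b. True}"
proof -
  have "Z4_pair 0 b = 2 * Psi b" for b :: "bit ^ 'n"
    by (simp add: vec_eq_iff Z4_pair_def Psi_def psi_def)
  moreover have "2 * Z4_pair a b = Z4_pair 0 a" for a b :: "bit ^ 'n"
  proof -
    have "2 * (2 :: 4) = 0" by simp
    then have "2 * (u + 2 * v) = 2 * u" for u v :: 4
      by (simp only: distrib_left mult.assoc [symmetric] mult_zero_left add_0_right)
    then show ?thesis by (simp add: vec_eq_iff Z4_pair_nth) (simp add: psi_def)
  qed
  ultimately show ?thesis
    unfolding two_Z4_def
  proof (intro set_eqI iffI)
    fix x :: "4 ^ 'n" assume "x \<in> range ((*) 2)"
    then obtain y where "x = 2 * y" by blast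
    moreover obtain a b where "y = Z4_pair a b" using Z4_pair_surj by blast
    ultimately show "x \<in> {Z4_pair 0 b | b. True}"
      using \<open>\<And>b a. 2 * Z4_pair a b = Z4_pair 0 a\<close> by auto
  qed auto
qed

lemma F2_representation_ex1:
  fixes D :: "(4 ^ 'n::finite) set"
  assumes "transversal two_Z4 D"
  shows "\<exists>!e. Z4_pair d e \<in> D"
proof -
  have *: "t - Z4_pair d 0 \<in> two_Z4 \<longleftrightarrow> (\<exists>e. t = Z4_pair d e)" for t
  proof -
    have "Z4_pair d e = Z4_pair d 0 + Z4_pair 0 e" for e
      by (simp add: vec_eq_iff Z4_pair_def Psi_def psi_def)
    then have "t = Z4_pair d e \<longleftrightarrow> t - Z4_pair d 0 = Z4_pair 0 e" for e
      by (metis diff_eq_eq add.commute)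
    then show ?thesis by (simp add: two_Z4_eq)
  qed
  have "\<exists>!t. t \<in> D \<and> (\<exists>e. t = Z4_pair d e)"
    using assms unfolding transversal_def * [symmetric] by blast
  then obtain t e where "t \<in> D" "t = Z4_pair d e"
    and uniq: "\<And>t'. t' \<in> D \<Longrightarrow> \<exists>e. t' = Z4_pair d e \<Longrightarrow> t' = t"
    by blast
  show ?thesis
  proof
    show "Z4_pair d e \<in> D" using \<open>t \<in> D\<close> \<open>t = _\<close> by simp
    show "e' = e" if "Z4_pair d e' \<in> D" for e'
      using uniq [OF that] \<open>t = _\<close> by (auto simp: Z4_pair_inject)
  qed
qed

lemma F2_representation:
  fixes D :: "(4 ^ 'n::finite) set"
  assumes "transversal two_Z4 D"
  shows "D = range (\<lambda>d. Z4_pair d (F2_representation D d))"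
proof -
  have *: "Z4_pair d e \<in> D \<longleftrightarrow> e = F2_representation D d" for d e
    unfolding F2_representation_def
    using F2_representation_ex1 [OF assms, of d] by (metis the_equality)
  show ?thesis
  proof (intro set_eqI)
    fix x :: "4 ^ 'n"
    obtain d e where "x = Z4_pair d e" using Z4_pair_surj by blast
    then show "x \<in> D \<longleftrightarrow> x \<in> range (\<lambda>d. Z4_pair d (F2_representation D d))"
      by (auto simp: * Z4_pair_inject)
  qed
qed

lemma two_eq_zero:
  assumes "CARD('f::{field,finite}) = 2 ^ m"
  shows "(2 :: 'f) = 0"
proof -
  have "(\<Sum>x\<in>(UNIV :: 'f set). x + 1) = (\<Sum>x\<in>UNIV. x)"
    by (rule sum.reindex_bij_witness [of _ "\<lambda>x. x - 1" "\<lambda>x. x + 1"]) auto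
  then have "(of_nat CARD('f) :: 'f) = 0" by (simp add: sum.distrib)
  then show ?thesis by (simp add: assms)
qed

lemma vector_space_F2_scale:
  assumes "(2 :: 'f::field) = 0"
  shows "vector_space (F2_scale :: bit \<Rightarrow> 'f \<Rightarrow> 'f)"
proof
  fix a b :: bit and x y :: 'f
  have "x + x = 0" using assms by (metis mult_2 mult_zero_left)
  then show "F2_scale (a + b) x = F2_scale a x + F2_scale b x"
    by (cases a; cases b) (simp_all add: F2_scale_def)
qed (auto simp: F2_scale_def)

lemma bij_of_coords:
  fixes \<xi> :: "'n::finite \<Rightarrow> 'f::field"
  assumes two: "(2 :: 'f) = 0" and "F2_basis \<xi>"
  shows "bij (of_coords \<xi>)"
proof -
  interpret vector_space "F2_scale :: bit \<Rightarrow> 'f \<Rightarrow> 'f" by (rule vector_space_F2_scale [OF two])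
  have inj: "inj \<xi>" and ind: "independent (range \<xi>)" and span: "span (range \<xi>) = UNIV"
    using assms(2) by (auto simp: F2_basis_def)
  have eq: "of_coords \<xi> (\<chi> i. u (\<xi> i)) = (\<Sum>x\<in>range \<xi>. F2_scale (u x) x)" for u
    by (simp add: of_coords_def sum.reindex [OF inj])
  show ?thesis
  proof (rule bijI)
    show "inj (of_coords \<xi>)"
    proof (rule injI)
      fix v w assume vw: "of_coords \<xi> v = of_coords \<xi> w"
      define u where "u = (\<lambda>x. v $ inv \<xi> x - w $ inv \<xi> x)"
      have "(\<Sum>x\<in>range \<xi>. F2_scale (u x) x) = of_coords \<xi> v - of_coords \<xi> w"
        by (simp only: eq [symmetric])
          (simp only: of_coords_def u_def inv_f_f [OF inj] scale_left_diff_distrib sum_subtractf vec_lambda_beta)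
      then have "\<forall>x\<in>range \<xi>. u x = 0"
        using ind vw dependent_finite [of "range \<xi>"] by auto
      then have "v $ i - w $ i = 0" for i by (simp add: u_def inv_f_f [OF inj] del: minus_bit_def)
      then show "v = w" by (simp add: vec_eq_iff del: minus_bit_def)
    qed
    show "surj (of_coords \<xi>)"
    proof (rule surjI)
      fix y
      have "y \<in> span (range \<xi>)" by (simp add: span)
      then have "\<exists>u. y = (\<Sum>x\<in>range \<xi>. F2_scale (u x) x)"
        by (subst (asm) span_finite) auto
      then have "\<exists>v. of_coords \<xi> v = y" using eq by metis
      then show "of_coords \<xi> (SOME v. of_coords \<xi> v = y) = y" by (rule someI_ex)
    qed
  qed
qed

lemma poly_of_map_ex1:
  fixes g :: "'f::{field,finite} \<Rightarrow> 'f"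
  shows "\<exists>!p. degree p < CARD('f) \<and> poly p = g"
proof
  define L where "L = (\<lambda>c::'f. \<Prod>d\<in>UNIV - {c}. smult (inverse (c - d)) [:- d, 1:])"
  define p where "p = (\<Sum>c\<in>UNIV. smult (g c) (L c))"
  have L: "poly (L c) x = (if x = c then 1 else 0)" for c x
  proof (cases "x = c")
    case True
    have "poly (smult (inverse (c - d)) [:- d, 1:]) c = inverse (c - d) * (c - d)" for d
      by (simp add: algebra_simps)
    then have "poly (L c) c = (\<Prod>d\<in>UNIV - {c}. inverse (c - d) * (c - d))"
      unfolding L_def poly_prod by (simp only:)
    also have "\<dots> = 1" by (rule prod.neutral) auto
    finally show ?thesis using True by simp
  next
    case False
    then show ?thesis by (auto simp: L_def poly_prod intro!: bexI [of _ x])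
  qed
  have "degree (L c) \<le> CARD('f) - 1" for c
  proof -
    have "degree (L c) \<le> (\<Sum>d\<in>UNIV - {c}. degree (smult (inverse (c - d)) [:- d, 1:]))"
      unfolding L_def by (rule order_trans [OF degree_prod_sum_le]) (simp_all add: comp_def)
    also have "\<dots> \<le> (\<Sum>d\<in>UNIV - {c}. 1)"
      by (rule sum_mono) (simp add: degree_smult_le)
    finally show ?thesis by simp
  qed
  then have "degree p \<le> CARD('f) - 1"
    unfolding p_def by (intro degree_sum_le) (auto intro: order_trans [OF degree_smult_le])
  moreover have "CARD('f) > 0" by simp
  ultimately have "degree p < CARD('f)" by linarith
  moreover have "poly p = g" by (auto simp: p_def poly_sum L if_distrib [of "(*) _"] cong: if_cong)
  ultimately show "degree p < CARD('f) \<and> poly p = g" by simp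
  fix q assume "degree q < CARD('f) \<and> poly q = g"
  then show "q = p"
    using \<open>degree p < CARD('f)\<close> \<open>poly p = g\<close>
    by (intro poly_eqI_degree [of UNIV]) auto
qed

lemma poly_of_map: "degree (poly_of_map g) < CARD('f)" "poly (poly_of_map g) = g"
  for g :: "'f::{field,finite} \<Rightarrow> 'f"
  using theI' [OF poly_of_map_ex1 [of g]] by (auto simp: poly_of_map_def)

end

theory Submission
  imports Defs
begin

text \<open>
  The difference of \<open>\<lfloor>d + a, h (d + a)\<rfloor>\<close> and \<open>\<lfloor>d, h d\<rfloor>\<close> is \<open>\<lfloor>a, \<Delta>\<^sub>h\<^sub>,\<^sub>a d\<rfloor>\<close>: the summand \<open>d \<odot> a\<close> is
  the carry of the addition in \<open>\<int>\<^sub>4\<close>. Hence the representations of \<open>\<lfloor>a, b\<rfloor>\<close> as a difference correspond to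
  the preimages of \<open>b\<close> under \<open>\<Delta>\<^sub>h\<^sub>,\<^sub>a\<close>. In the field, expanding the product \<open>x a\<close> in coordinates shows that
  \<open>x a\<close> differs from the polarization of \<open>\<mu>\<^sub>B\<close> by \<open>\<Sum>\<^sub>i x\<^sub>i a\<^sub>i \<xi>\<^sub>i\<^sup>2\<close>, the square of the element with
  coordinates \<open>x \<odot> a\<close>. Thus \<open>\<nabla>\<^sub>f\<^sub>,\<^sub>a\<close> is \<open>\<Delta>\<^sub>h\<^sub>,\<^sub>a\<close> in coordinates, followed by a translation and by the
  Frobenius automorphism.
\<close>

section \<open>Subtraction in pair coordinates and cardinalities\<close>

lemma bit_vec_add_self: "v + (v + w) = w" for v w :: "bit ^ 'n::finite"
proof -
  have "c + (c + e) = e" for c e :: bit by (cases c; cases e) simp_all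
  then show ?thesis by (simp only: vec_eq_iff vector_add_component simp_thms)
qed

text \<open>A borrow occurs only for \<open>c = a = 1\<close>, where the difference of the
  \<open>psi\<close> values is \<open>-1 = 1 + 2\<close>; this is the term \<open>c * a\<close>. The
  bit \<open>e\<close> enters with a plus sign because \<open>-2 = 2\<close> modulo 4.\<close>

lemma psi_diff: "psi (c + a) + 2 * psi e' - (psi c + 2 * psi e) = psi a + 2 * psi (e' + e + c * a)"
  by (cases c; cases a; cases e; cases e') (simp_all add: psi_def)

lemma Z4_pair_diff: "Z4_pair (d + a) (h (d + a)) - Z4_pair d (h d) = Z4_pair a (Delta h a d)"
  by (simp only: vec_eq_iff vector_minus_component Z4_pair_nth vector_add_component psi_diff
      Delta_def odot_def vec_lambda_beta simp_thms)

lemma Z4_pair_mem_two_Z4: "Z4_pair a b \<in> two_Z4 \<longleftrightarrow> a = 0"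
  by (auto simp: two_Z4_eq Z4_pair_inject)

lemma add_subgroup_two_Z4: "add_subgroup (two_Z4 :: (4 ^ 'n::finite) set)"
  unfolding add_subgroup_def two_Z4_def
proof (intro conjI ballI)
  show "(0 :: 4 ^ 'n) \<in> range ((*) 2)" by (rule range_eqI [of _ _ 0]) simp
  fix x y :: "4 ^ 'n" assume "x \<in> range ((*) 2)" "y \<in> range ((*) 2)"
  then obtain u v where "x = 2 * u" "y = 2 * v" by blast
  then have "x - y = 2 * (u - v)" by (simp only: vec_eq_iff) (simp add: right_diff_distrib)
  then show "x - y \<in> range ((*) 2)" by blast
qed

lemma card_bit: "CARD(bit) = 2"
proof -
  have UNIV: "(UNIV :: bit set) = {0, 1}" by (auto intro: bit.exhaust)
  show ?thesis unfolding UNIV by simp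
qed

lemma card_bit_vec: "CARD(bit ^ 'n::finite) = 2 ^ CARD('n)"
  by (simp add: card_bit)

lemma card_two_Z4: "card (two_Z4 :: (4 ^ 'n::finite) set) = 2 ^ CARD('n)"
proof -
  have "two_Z4 = range (Z4_pair 0 :: bit ^ 'n \<Rightarrow> 4 ^ 'n)" by (auto simp: two_Z4_eq)
  moreover have "inj (Z4_pair 0 :: bit ^ 'n \<Rightarrow> 4 ^ 'n)" by (rule injI) (simp add: Z4_pair_inject)
  ultimately show ?thesis by (metis card_image card_bit_vec)
qed

lemma card_graph: "card (range (\<lambda>d. Z4_pair d (h d))) = 2 ^ CARD('n)"
  for h :: "bit ^ 'n::finite \<Rightarrow> bit ^ 'n"
proof -
  have "inj (\<lambda>d. Z4_pair d (h d))" by (rule injI) (simp add: Z4_pair_inject)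
  then show ?thesis by (simp only: card_image card_bit_vec)
qed

text \<open>A representation of the difference is determined by its subtrahend, so \<open>d\<close>
  parametrizes the representations by a fibre of \<open>Delta h a\<close>.\<close>

lemma card_differences:
  fixes h :: "bit ^ 'n::finite \<Rightarrow> bit ^ 'n"
  assumes D: "D = range (\<lambda>d. Z4_pair d (h d))"
  shows "card {(x, x'). x \<in> D \<and> x' \<in> D \<and> x - x' = Z4_pair a b} = card {d. Delta h a d = b}"
proof -
  let ?g = "\<lambda>d. (Z4_pair (d + a) (h (d + a)), Z4_pair d (h d))"
  have "{(x, x'). x \<in> D \<and> x' \<in> D \<and> x - x' = Z4_pair a b} = ?g ` {d. Delta h a d = b}"
  proof (intro set_eqI iffI)
    fix p assume "p \<in> {(x, x'). x \<in> D \<and> x' \<in> D \<and> x - x' = Z4_pair a b}"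
    then obtain e d where p: "p = (Z4_pair e (h e), Z4_pair d (h d))"
      and "Z4_pair e (h e) - Z4_pair d (h d) = Z4_pair a b"
      by (auto simp: D)
    \<comment> \<open>Every pair of elements of \<open>D\<close> has the form covered by
      \<open>Z4_pair_diff\<close>, with shift \<open>d + e\<close>, since each vector is its own
      negative.\<close>
    moreover have e: "e = d + (d + e)" by (simp only: bit_vec_add_self)
    ultimately have "Z4_pair (d + e) (Delta h (d + e) d) = Z4_pair a b"
      using Z4_pair_diff [of d "d + e" h] by (simp only:)
    then have "a = d + e" "Delta h a d = b" by (auto simp: Z4_pair_inject)
    then show "p \<in> ?g ` {d. Delta h a d = b}"
      using e p by (intro image_eqI [of _ _ d]) simp_all
  qed (auto simp: D Z4_pair_diff)
  moreover have "inj ?g" by (rule injI) (simp add: Z4_pair_inject)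
  ultimately show ?thesis by (simp only: card_image inj_on_subset [OF _ subset_UNIV])
qed

text \<open>Turns the condition \<lambda> = 1 into bijectivity: a fibre of size one gives existence
  and uniqueness of a preimage at once.\<close>

lemma bij_iff_card_vimage: "bij g \<longleftrightarrow> (\<forall>y. card {x. g x = y} = 1)"
proof -
  have "card {x. g x = y} = 1 \<longleftrightarrow> (\<exists>!x. g x = y)" for y
    unfolding One_nat_def card_1_singleton_iff set_eq_iff mem_Collect_eq singleton_iff Ex1_def
    by blast
  then show ?thesis by (simp add: bij_iff)
qed

lemma relative_difference_set_iff_Delta:
  fixes D :: "(4 ^ 'n::finite) set"
  assumes D: "D = range (\<lambda>d. Z4_pair d (h d))"
  shows "relative_difference_set (2 ^ CARD('n)) (2 ^ CARD('n)) (2 ^ CARD('n)) 1 two_Z4 D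
    \<longleftrightarrow> (\<forall>a. a \<noteq> 0 \<longrightarrow> bij (Delta h a))"
proof -
  have "CARD(4 ^ 'n) = 2 ^ CARD('n) * 2 ^ CARD('n)"
    by (simp add: power_mult_distrib [symmetric])
  \<comment> \<open>The forbidden subgroup: a difference in \<open>two_Z4\<close> forces equal first
    coordinates, and on the graph of \<open>h\<close> these determine the element.\<close>
  moreover have "g = 0" if g: "g \<in> two_Z4" "x - x' = g" and x: "x \<in> D" "x' \<in> D" for g x x' :: "4 ^ 'n"
  proof -
    obtain e d where e: "x = Z4_pair e (h e)" and d: "x' = Z4_pair d (h d)"
      using x unfolding D by blast
    have "x - x' = Z4_pair (d + e) (Delta h (d + e) d)"
      using Z4_pair_diff [of d "d + e" h] by (simp only: e d bit_vec_add_self)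
    then have "d + e = 0" using g by (simp add: Z4_pair_mem_two_Z4)
    then have "d = e" using bit_vec_add_self [of d e] by simp
    then show ?thesis using g e d by simp
  qed
  moreover have "(\<forall>g. g \<notin> two_Z4 \<longrightarrow> card {(x, x'). x \<in> D \<and> x' \<in> D \<and> x - x' = g} = 1)
      \<longleftrightarrow> (\<forall>a. a \<noteq> 0 \<longrightarrow> bij (Delta h a))"
  proof -
    \<comment> \<open>The elements outside \<open>two_Z4\<close> are the pairs with
      \<open>a \<noteq> 0\<close> and arbitrary \<open>b\<close>, so the quantifier splits.\<close>
    have "(\<forall>g. g \<notin> two_Z4 \<longrightarrow> P g) \<longleftrightarrow> (\<forall>a. a \<noteq> 0 \<longrightarrow> (\<forall>b. P (Z4_pair a b)))" for P :: "4 ^ 'n \<Rightarrow> bool"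
      by (metis Z4_pair_mem_two_Z4 Z4_pair_surj)
    then show ?thesis by (simp only: bij_iff_card_vimage card_differences [OF D])
  qed
  ultimately show ?thesis
    unfolding relative_difference_set_def
    using add_subgroup_two_Z4 card_two_Z4 card_graph [of h, folded D] by blast
qed

section \<open>Characteristic 2 and the polarization of \<open>mu_B\<close>\<close>

lemma sum_mult_sum_triangle:
  fixes u v :: "'n::{finite,linorder} \<Rightarrow> 'a::comm_ring"
  shows "sum u UNIV * sum v UNIV = (\<Sum>i\<in>UNIV. u i * v i) + (\<Sum>(i, j) | i < j. u i * v j + v i * u j)"
proof -
  \<comment> \<open>The index square splits into the diagonal and two triangles; \<open>swap\<close>
    transposes the lower triangle onto the upper one.\<close>
  have UNIV: "(UNIV :: ('n \<times> 'n) set) = {(i, j). i = j} \<union> ({(i, j). i < j} \<union> {(i, j). j < i})"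
    by auto
  have diag: "(\<Sum>(i, j) | i = j. u i * v j) = (\<Sum>i\<in>UNIV. u i * v i)"
    by (rule sum.reindex_bij_witness [of _ "\<lambda>i. (i, i)" fst]) auto
  have swap: "(\<Sum>(i, j) | j < i. u i * v j) = (\<Sum>(i, j) | i < j. v i * u j)"
    by (rule sum.reindex_bij_witness [of _ prod.swap prod.swap]) (auto simp: mult.commute)
  have "sum u UNIV * sum v UNIV = (\<Sum>(i, j)\<in>UNIV. u i * v j)"
    by (simp add: sum_product sum.cartesian_product)
  also have "\<dots> = (\<Sum>(i, j) | i = j. u i * v j)
      + ((\<Sum>(i, j) | i < j. u i * v j) + (\<Sum>(i, j) | j < i. u i * v j))"
    unfolding UNIV by (subst sum.union_disjoint; (subst sum.union_disjoint)?) auto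
  also have "\<dots> = (\<Sum>i\<in>UNIV. u i * v i) + (\<Sum>(i, j) | i < j. u i * v j + v i * u j)"
    unfolding diag swap by (simp add: sum.distrib split_def)
  finally show ?thesis .
qed

lemma add_self_char2:
  fixes x :: "'f::field"
  assumes "(2 :: 'f) = 0"
  shows "x + x = 0"
  using assms by (metis mult_2 mult_zero_left)

lemma power2_add_char2:
  fixes x y :: "'f::field"
  assumes "(2 :: 'f) = 0"
  shows "(x + y)\<^sup>2 = x\<^sup>2 + y\<^sup>2"
  using assms by (simp add: power2_sum)

lemma power2_sum_char2:
  fixes g :: "'a \<Rightarrow> 'f::field"
  assumes "(2 :: 'f) = 0"
  shows "(sum g A)\<^sup>2 = (\<Sum>i\<in>A. (g i)\<^sup>2)"
  by (induction A rule: infinite_finite_induct) (simp_all add: power2_add_char2 [OF assms])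

lemma bij_power2_char2:
  assumes "(2 :: 'f::{field,finite}) = 0"
  shows "bij (\<lambda>x :: 'f::{field,finite}. x\<^sup>2)"
proof -
  have "x = y" if "x\<^sup>2 = y\<^sup>2" for x y :: 'f
  proof -
    have "(x - y)\<^sup>2 = (x + y)\<^sup>2 - 2 * (2 * x * y)" by (simp add: power2_eq_square algebra_simps)
    also have "\<dots> = y\<^sup>2 + y\<^sup>2" by (simp add: assms power2_add_char2 that)
    finally show ?thesis by (simp add: add_self_char2 [OF assms])
  qed
  then show ?thesis by (simp add: bij_def inj_def finite_UNIV_inj_surj)
qed

lemma of_coords_add:
  fixes \<xi> :: "'n::finite \<Rightarrow> 'f::field"
  assumes "(2 :: 'f) = 0"
  shows "of_coords \<xi> (v + w) = of_coords \<xi> v + of_coords \<xi> w"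
proof -
  interpret vector_space "F2_scale :: bit \<Rightarrow> 'f \<Rightarrow> 'f" by (rule vector_space_F2_scale [OF assms])
  show ?thesis by (simp only: of_coords_def vector_add_component scale_left_distrib sum.distrib)
qed

lemma F2_scale_mult: "F2_scale (c * e) (x * y) = F2_scale c x * F2_scale e y"
  by (simp add: F2_scale_def)

lemma F2_scale_add:
  fixes x :: "'f::field"
  assumes "(2 :: 'f) = 0"
  shows "F2_scale (c + e) x = F2_scale c x + F2_scale e x"
proof -
  interpret vector_space "F2_scale :: bit \<Rightarrow> 'f \<Rightarrow> 'f" by (rule vector_space_F2_scale [OF assms])
  show ?thesis by (rule scale_left_distrib)
qed

lemma coords_of_coords:
  fixes \<xi> :: "'n::finite \<Rightarrow> 'f::field"
  assumes "(2 :: 'f) = 0" and "F2_basis \<xi>"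
  shows "coords \<xi> (of_coords \<xi> v) = v"
  unfolding coords_def using bij_of_coords [OF assms] by (simp add: bij_is_inj)

lemma mu_B_of_coords:
  fixes \<xi> :: "'n::{finite,linorder} \<Rightarrow> 'f::field"
  assumes "(2 :: 'f) = 0" and "F2_basis \<xi>"
  shows "mu_B \<xi> (of_coords \<xi> v)
    = (\<Sum>(i, j) | i < j. F2_scale (v $ i) (\<xi> i) * F2_scale (v $ j) (\<xi> j))"
  by (simp only: mu_B_def coords_of_coords [OF assms] F2_scale_mult)

lemma mu_B_polarization:
  fixes \<xi> :: "'n::{finite,linorder} \<Rightarrow> 'f::field"
  assumes two: "(2 :: 'f) = 0" and "F2_basis \<xi>"
  defines "m \<equiv> \<lambda>v. mu_B \<xi> (of_coords \<xi> v)"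
  shows "m (v + w) + m v + m w + of_coords \<xi> v * of_coords \<xi> w = (of_coords \<xi> (v \<odot> w))\<^sup>2"
proof -
  define X where "X i = F2_scale (v $ i) (\<xi> i)" for i
  define Y where "Y i = F2_scale (w $ i) (\<xi> i)" for i
  \<comment> \<open>The mixed terms: \<open>S\<close> arises both from polarizing
    \<open>mu_B\<close> and from the product of the two field elements, so it will cancel.\<close>
  define S where "S = (\<Sum>(i, j) | i < j. X i * Y j + Y i * X j)"
  have mv: "m v = (\<Sum>(i, j) | i < j. X i * X j)" and mw: "m w = (\<Sum>(i, j) | i < j. Y i * Y j)"
    unfolding m_def mu_B_of_coords [OF two assms(2)] X_def Y_def by (rule refl)+
  have "m (v + w) = (\<Sum>(i, j) | i < j. (X i + Y i) * (X j + Y j))"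
    unfolding m_def mu_B_of_coords [OF two assms(2)] X_def Y_def vector_add_component
      F2_scale_add [OF two] by (rule refl)
  also have "\<dots> = m v + m w + S"
    by (simp add: mv mw S_def sum.distrib [symmetric] split_def algebra_simps)
  finally have sum: "m (v + w) = m v + m w + S" .
  have "of_coords \<xi> v * of_coords \<xi> w = (\<Sum>i\<in>UNIV. X i * Y i) + S"
    unfolding of_coords_def X_def [symmetric] Y_def [symmetric] S_def by (rule sum_mult_sum_triangle)
  \<comment> \<open>The diagonal is a square because squaring is additive and bits are
    idempotent.\<close>
  moreover have "(of_coords \<xi> (v \<odot> w))\<^sup>2 = (\<Sum>i\<in>UNIV. X i * Y i)"
    unfolding of_coords_def power2_sum_char2 [OF two] X_def Y_def odot_def
    by (rule sum.cong) (auto simp: F2_scale_def power2_eq_square)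
  ultimately have "m (v + w) + m v + m w + of_coords \<xi> v * of_coords \<xi> w
      = (of_coords \<xi> (v \<odot> w))\<^sup>2 + (m v + m v) + (m w + m w) + (S + S)"
    by (simp add: sum algebra_simps)
  then show ?thesis by (simp add: add_self_char2 [OF two])
qed

section \<open>Transfer from \<open>nabla\<close> to \<open>Delta\<close>\<close>

lemma poly_nabla: "poly (nabla f a) x = poly f (x + a) + poly f x + poly f a + x * a"
  by (simp add: nabla_def poly_pcompose add.commute)

lemma poly_nabla_of_coords:
  fixes \<xi> :: "'n::{finite,linorder} \<Rightarrow> 'f::{field,finite}" and D :: "(4 ^ 'n::{finite,linorder}) set"
  assumes two: "(2 :: 'f) = 0" and basis: "F2_basis \<xi>"
  defines "h \<equiv> F2_representation D"
  shows "poly (nabla (Fq_representation \<xi> D) (of_coords \<xi> a)) (of_coords \<xi> v)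
    = (of_coords \<xi> (Delta h a v) + of_coords \<xi> (h a))\<^sup>2"
proof -
  have f: "poly (Fq_representation \<xi> D) (of_coords \<xi> v) = (of_coords \<xi> (h v))\<^sup>2 + mu_B \<xi> (of_coords \<xi> v)"
    for v
    by (simp add: Fq_representation_def poly_of_map h_B_def h_def coords_of_coords [OF two basis])
  show ?thesis
    unfolding poly_nabla of_coords_add [OF two, symmetric] f
    \<comment> \<open>Polarization is read from right to left: the square of the
      \<open>v \<odot> a\<close> part becomes the \<open>mu_B\<close> terms plus the field product,
      after which both sides are the same sum.\<close>
    unfolding Delta_def of_coords_add [OF two] power2_add_char2 [OF two]
      mu_B_polarization [OF two basis, symmetric]
    by (simp add: of_coords_add [OF two] algebra_simps)
qed

lemma permutation_polynomial_nabla_iff: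
  fixes \<xi> :: "'n::{finite,linorder} \<Rightarrow> 'f::{field,finite}" and D :: "(4 ^ 'n::{finite,linorder}) set"
  assumes two: "(2 :: 'f) = 0" and basis: "F2_basis \<xi>"
  shows "permutation_polynomial (nabla (Fq_representation \<xi> D) (of_coords \<xi> a))
    \<longleftrightarrow> bij (Delta (F2_representation D) a)"
proof -
  let ?p = "poly (nabla (Fq_representation \<xi> D) (of_coords \<xi> a))"
  \<comment> \<open>Coordinates, translation and Frobenius are bijections, so composing with them
    does not affect bijectivity.\<close>
  let ?g = "(\<lambda>x. x\<^sup>2) \<circ> (\<lambda>x. x + of_coords \<xi> (F2_representation D a)) \<circ> of_coords \<xi>"
  note bij = bij_of_coords [OF two basis]
  have "bij (\<lambda>x. x + c)" for c :: 'f
    by (rule bij_betw_byWitness [of _ "\<lambda>x. x - c"]) auto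
  then have g: "bij ?g" by (intro bij_comp bij bij_power2_char2 [OF two])
  have "?p \<circ> of_coords \<xi> = ?g \<circ> Delta (F2_representation D) a"
    by (simp add: fun_eq_iff poly_nabla_of_coords [OF two basis])
  moreover have "bij ?p \<longleftrightarrow> bij (?p \<circ> of_coords \<xi>)" using bij bij_betw_comp_iff by blast
  moreover have "bij (?g \<circ> Delta (F2_representation D) a) \<longleftrightarrow> bij (Delta (F2_representation D) a)"
    using g bij_betw_comp_iff2 [of ?g UNIV UNIV "Delta (F2_representation D) a" UNIV] by simp
  ultimately show ?thesis unfolding permutation_polynomial_def by simp
qed

theorem theorem2p1:
  fixes D :: "(4 ^ 'n::{finite,linorder}) set"
    and \<xi> :: "'n \<Rightarrow> 'f::{field,finite}"
    and h :: "bit ^ 'n::{finite,linorder} \<Rightarrow> bit ^ 'n::{finite,linorder}"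
    and f :: "'f poly"
  assumes "CARD('f) = 2 ^ CARD('n)"
    and "transversal two_Z4 D"
    and "h = F2_representation D"
    and "F2_basis \<xi>"
    and "f = Fq_representation \<xi> D"
  shows "(relative_difference_set (2 ^ CARD('n)) (2 ^ CARD('n)) (2 ^ CARD('n)) 1 two_Z4 D
            \<longleftrightarrow> (\<forall>a. a \<noteq> 0 \<longrightarrow> bij (Delta h a)))
       \<and> ((\<forall>a. a \<noteq> 0 \<longrightarrow> bij (Delta h a))
            \<longleftrightarrow> (\<forall>a. a \<noteq> 0 \<longrightarrow> permutation_polynomial (nabla f a)))"
proof
  have two: "(2 :: 'f) = 0" by (rule two_eq_zero [OF assms(1)])
  note bij = bij_of_coords [OF two assms(4)]
  have "D = range (\<lambda>d. Z4_pair d (h d))"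
    unfolding assms(3) by (rule F2_representation [OF assms(2)])
  then show "relative_difference_set (2 ^ CARD('n)) (2 ^ CARD('n)) (2 ^ CARD('n)) 1 two_Z4 D
      \<longleftrightarrow> (\<forall>a. a \<noteq> 0 \<longrightarrow> bij (Delta h a))"
    by (rule relative_difference_set_iff_Delta)
  have "of_coords \<xi> 0 = 0" by (simp add: of_coords_def F2_scale_def)
  \<comment> \<open>Nonzero field elements correspond to nonzero vectors, so the quantifier over the
    field can be taken over coordinates.\<close>
  then have "of_coords \<xi> v = 0 \<longleftrightarrow> v = 0" for v using bij by (metis bij_pointE)
  moreover have "(\<forall>x. P x) \<longleftrightarrow> (\<forall>v. P (of_coords \<xi> v))" for P
    using bij by (metis bij_pointE)
  ultimately show "(\<forall>a. a \<noteq> 0 \<longrightarrow> bij (Delta h a))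
      \<longleftrightarrow> (\<forall>a. a \<noteq> 0 \<longrightarrow> permutation_polynomial (nabla f a))"
    unfolding assms(3,5) permutation_polynomial_nabla_iff [OF two assms(4), symmetric]
    by presburger
qed

end
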